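(* Let $\varepsilon_0,\varepsilon_1,\varepsilon_2>0$. The three-step group randomized response mechanism (GroupRR) described in the context, run with privacy budget $\varepsilon_0$ in the degree sharing step, $\varepsilon_1$ in the group randomized response step and $\varepsilon_2$ in the counting step, has privacy budget $\varepsilon_0+\varepsilon_1+\varepsilon_2$; that is, it is $(\varepsilon_0+\varepsilon_1+\varepsilon_2)$-edge locally differentially private.
   Context: Privacy notion. Users $v_1,\dots,v_n$ are the nodes of a simple graph $G=(V,E)$; user $v_i$ holds the adjacency list $a_i=(a_{i,1},\dots,a_{i,n})\in\{0,1\}^n$ with $a_{i,j}=1$ iff $\{v_i,v_j\}\in E$. A randomized query $\mathcal R$ to user $v_i$ is $\epsilon$-edge locally differentially private if $\Pr[\mathcal R(a)\in S]\le e^{\epsilon}\Pr[\mathcal R(a')\in S]$ for all $a,a'\in\{0,1\}^n$ with $\ell_1$-distance at most $1$ and all sets $S$ of outcomes. An algorithm is $\epsilon$-edge locally differentially private if, for every user, each query it poses to that user (chosen possibly depending on previously published messages) is $\epsilon_r$-edge locally differentially private for some $\epsilon_r$ and the sum of the $\epsilon_r$ over the queries to that user is at most $\epsilon$. "Privacy budget $\epsilon$" means $\epsilon$-edge locally differentially private. Mechanism GroupRR, with sampling size $s\ge 1$ (an integer), $p$ the smallest prime larger than $n$, $m=\lceil p/s\rceil\ge 2$, $\varepsilon'=\ln(1+s(e^{\varepsilon_1}-1))$: Step 1 (degree sharing). User $v_i$ publishes $\tilde d_i=d_i+L_i$, where $d_i=|\{j<i:\{v_i,v_j\}\in E\}|$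 and $L_i$ is Laplace noise of scale $1/\varepsilon_0$. Step 2 (group randomized response). The server publishes, for every $i$, random $(\theta_i,\phi_i)$ uniform in $\{1,\dots,p-1\}\times\{0,\dots,p-1\}$, chosen independently of the graph, defining $h_i(j)=((\theta_i j+\phi_i)\bmod p)\bmod m$. User $v_i$ forms the $m$ groups $S_{i,t}=\{v_j:h_i(j)=t\}$, each padded with dummy elements (non-neighbours of $v_i$) to size exactly $s$; from each group an element $v_{c_t}$ is drawn uniformly and independently (the index $c_t$ is never published). The bit $a_{i,c_t}$ (replaced by $0$ if $c_t>i$ or if the element is a dummy) is passed through randomized response with budget $\varepsilon'$: the published bit $a'_{i,c_t}$ equals the input bit with probability $e^{\varepsilon'}/(1+e^{\varepsilon'})$ and its complement with probability $1/(1+e^{\varepsilon'})$, independently for all $t$. For $t=h_i(k)$, write $a'_{i,h_i(k)}$ for $a'_{i,c_t}$. Step 3 (counting, for triangles). Put $\omega=\frac{e^{\varepsilon'}+1}{e^{\varepsilon'}-1}\cdot\frac{ms-1}{m-1}$, $\tilde\sigma_k=\frac{s-1}{ms-s}\tilde d_k+\frac{1}{e^{\varepsilon'}-1}\cdot\frac{ms-1}{m-1}$ and $\tilde a_{k,h_k(j)}=\omega a'_{k,h_k(j)}-\tilde\sigma_k$; these depend only on published data. For $a\in\{0,1\}^n$ let $f_i(a)=\sum_{j<k<i,\;a_j=a_k=1}\tilde a_{k,h_k(j)}$. User $v_i$ sends to the server $f_i(a_i)$ perturbed with budget $\varepsilon_2$ by one of the following two mechanisms. (i) Local Laplacian mechanism: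 add Laplace noise of scale $\Delta/\varepsilon_2$, with $\Delta=\max|f_i(a)-f_i(a')|$ over $a,a'$ at $\ell_1$-distance $1$. (ii) Smooth sensitivity mechanism: add $\frac{2(\gamma-1)}{\varepsilon_2}S^*(a_i)Z$, where $\gamma=4$, $Z$ has density proportional to $1/(1+|z|^\gamma)$, and $S^*(a)=\max_{k\ge 0}e^{-\beta k}A^{(k)}(a)$ with $\beta=\varepsilon_2/(2(\gamma-1))$, where $A^{(k)}(a)$ is the maximum of $\mathrm{LS}(a')$ over $a'$ at $\ell_1$-distance at most $k$ from $a$, and $\mathrm{LS}(a')=\max|f_i(a')-f_i(a'')|$ over $a''$ at distance $1$ from $a'$. The server publishes the sum of the received values. *)

theory Defs
  imports "HOL-Probability.Probability" "HOL-Computational_Algebra.Primes"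
begin

section \<open>Edge local differential privacy\<close>

text \<open>
  The users are the numbers \<open>1, \<dots>, n\<close>.  Entry \<open>j\<close> of an adjacency list tells whether the
  user holding the list is adjacent to user \<open>j\<close>.
\<close>

definition adj_lists :: "nat \<Rightarrow> (nat \<Rightarrow> bool) set" where
  "adj_lists n = {1..n} \<rightarrow>\<^sub>E UNIV"

definition l1_dist :: "nat \<Rightarrow> (nat \<Rightarrow> bool) \<Rightarrow> (nat \<Rightarrow> bool) \<Rightarrow> int" where
  "l1_dist n a a' = (\<Sum>j=1..n. \<bar>of_bool (a j) - of_bool (a' j)\<bar>)"

type_synonym 'm query = "(nat \<Rightarrow> bool) \<Rightarrow> 'm measure"

definition edge_ldp_query :: "nat \<Rightarrow> real \<Rightarrow> 'm query \<Rightarrow> bool" where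
  "edge_ldp_query n \<epsilon> R \<longleftrightarrow>
     (\<forall>a\<in>adj_lists n. prob_space (R a)) \<and>
     (\<forall>a\<in>adj_lists n. \<forall>a'\<in>adj_lists n. sets (R a) = sets (R a')) \<and>
     (\<forall>a\<in>adj_lists n. \<forall>a'\<in>adj_lists n. l1_dist n a a' \<le> 1 \<longrightarrow>
        (\<forall>S\<in>sets (R a). measure (R a) S \<le> exp \<epsilon> * measure (R a') S))"

text \<open>
  An interactive algorithm is a tree.  At an inner node the server either draws public randomness,
  which has no access to the graph, or poses a query to a user, who answers with a sample of the
  query's distribution at the user's own adjacency list.  In both cases the resulting message is
  published and the rest of the algorithm may depend on it; a leaf carries the final output.
\<close>

datatype ('m, 'o) protocol =
    Output 'o
  | Server "'m measure" "'m \<Rightarrow> ('m, 'o) protocol"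
  | Ask nat "'m query" "'m \<Rightarrow> ('m, 'o) protocol"

text \<open>
  \<open>poses n P qs\<close>: some sequence of possible messages makes \<open>P\<close> pose exactly the queries \<open>qs\<close>, each
  paired with the user it is addressed to.
\<close>

inductive poses :: "nat \<Rightarrow> ('m, 'o) protocol \<Rightarrow> (nat \<times> 'm query) list \<Rightarrow> bool" for n where
  Output: "poses n (Output x) []"
| Server: "msg \<in> space M \<Longrightarrow> poses n (K msg) qs \<Longrightarrow> poses n (Server M K) qs"
| Ask: "a \<in> adj_lists n \<Longrightarrow> msg \<in> space (R a) \<Longrightarrow> poses n (K msg) qs
         \<Longrightarrow> poses n (Ask u R K) ((u, R) # qs)"

definition queries_to :: "nat \<Rightarrow> (nat \<times> 'm query) list \<Rightarrow> 'm query list" where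
  "queries_to u qs = map snd (filter (\<lambda>q. fst q = u) qs)"

text \<open>
  The per-query budgets may differ between runs, since the queries may.  No budget can be negative,
  as is seen by comparing a list with itself in \<^const>\<open>edge_ldp_query\<close>.
\<close>

definition edge_ldp :: "nat \<Rightarrow> real \<Rightarrow> ('m, 'o) protocol \<Rightarrow> bool" where
  "edge_ldp n \<epsilon> P \<longleftrightarrow>
     (\<forall>u\<in>{1..n}. \<forall>qs. poses n P qs \<longrightarrow>
        (\<exists>es. list_all2 (edge_ldp_query n) es (queries_to u qs) \<and> sum_list es \<le> \<epsilon>))"

primrec ask_each ::
    "nat list \<Rightarrow> (nat \<Rightarrow> 'm query) \<Rightarrow> ((nat \<Rightarrow> 'm) \<Rightarrow> ('m, 'o) protocol) \<Rightarrow> ('m, 'o) protocol" where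
  "ask_each [] R K = K (\<lambda>_. undefined)"
| "ask_each (i # is) R K = Ask i (R i) (\<lambda>msg. ask_each is R (\<lambda>msgs. K (msgs(i := msg))))"

primrec server_each ::
    "nat list \<Rightarrow> (nat \<Rightarrow> 'm measure) \<Rightarrow> ((nat \<Rightarrow> 'm) \<Rightarrow> ('m, 'o) protocol) \<Rightarrow> ('m, 'o) protocol" where
  "server_each [] M K = K (\<lambda>_. undefined)"
| "server_each (i # is) M K = Server (M i) (\<lambda>msg. server_each is M (\<lambda>msgs. K (msgs(i := msg))))"


section \<open>Noise\<close>

text \<open>Scale \<open>0\<close>, which arises when a function has sensitivity \<open>0\<close>, means no noise.\<close>

definition laplace :: "real \<Rightarrow> real measure" where
  "laplace b =
     (if b = 0 then return borel 0
      else density lborel (\<lambda>z. ennreal (exp (- \<bar>z\<bar> / b) / (2 * b))))"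

definition poly_tail :: "nat \<Rightarrow> real measure" where
  "poly_tail \<gamma> =
     density lborel (\<lambda>z. ennreal ((1 / (1 + \<bar>z\<bar> ^ \<gamma>)) / (LINT y|lborel. 1 / (1 + \<bar>y\<bar> ^ \<gamma>))))"

definition laplace_mech :: "real \<Rightarrow> real \<Rightarrow> real measure" where
  "laplace_mech b x = distr (laplace b) borel (\<lambda>z. x + z)"

definition global_sens :: "nat \<Rightarrow> ((nat \<Rightarrow> bool) \<Rightarrow> real) \<Rightarrow> real" where
  "global_sens n f =
     Max {\<bar>f a - f a'\<bar> | a a'. a \<in> adj_lists n \<and> a' \<in> adj_lists n \<and> l1_dist n a a' = 1}"

definition local_sens :: "nat \<Rightarrow> ((nat \<Rightarrow> bool) \<Rightarrow> real) \<Rightarrow> (nat \<Rightarrow> bool) \<Rightarrow> real" where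
  "local_sens n f a = Max {\<bar>f a - f a'\<bar> | a'. a' \<in> adj_lists n \<and> l1_dist n a a' = 1}"

definition local_sens_at ::
    "nat \<Rightarrow> ((nat \<Rightarrow> bool) \<Rightarrow> real) \<Rightarrow> nat \<Rightarrow> (nat \<Rightarrow> bool) \<Rightarrow> real" where
  "local_sens_at n f k a = Max {local_sens n f a' | a'. a' \<in> adj_lists n \<and> l1_dist n a a' \<le> int k}"

text \<open>The supremum is a maximum, because \<open>local_sens_at n f k a\<close> is constant in \<open>k\<close> for \<open>k \<ge> n\<close>.\<close>

definition smooth_sens :: "nat \<Rightarrow> ((nat \<Rightarrow> bool) \<Rightarrow> real) \<Rightarrow> real \<Rightarrow> (nat \<Rightarrow> bool) \<Rightarrow> real" where
  "smooth_sens n f \<beta> a = (SUP k::nat. exp (- \<beta> * real k) * local_sens_at n f k a)"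

datatype counting_mech = Local_Laplacian | Smooth_Sensitivity

primrec perturb ::
    "counting_mech \<Rightarrow> nat \<Rightarrow> real \<Rightarrow> ((nat \<Rightarrow> bool) \<Rightarrow> real) \<Rightarrow> (nat \<Rightarrow> bool) \<Rightarrow> real measure" where
  "perturb Local_Laplacian n \<epsilon> f a = laplace_mech (global_sens n f / \<epsilon>) (f a)"
| "perturb Smooth_Sensitivity n \<epsilon> f a =
     (let \<gamma> = 4; \<beta> = \<epsilon> / (2 * (real \<gamma> - 1))
      in distr (poly_tail \<gamma>) borel
           (\<lambda>z. f a + 2 * (real \<gamma> - 1) / \<epsilon> * smooth_sens n f \<beta> a * z))"


section \<open>GroupRR\<close>

definition hash_prime :: "nat \<Rightarrow> nat" where
  "hash_prime n = (LEAST p. prime p \<and> n < p)"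

definition num_groups :: "nat \<Rightarrow> nat \<Rightarrow> nat" where
  "num_groups n s = nat \<lceil>real (hash_prime n) / real s\<rceil>"

definition rr_budget :: "nat \<Rightarrow> real \<Rightarrow> real" where
  "rr_budget s \<epsilon>1 = ln (1 + real s * (exp \<epsilon>1 - 1))"

definition hash :: "nat \<Rightarrow> nat \<Rightarrow> nat \<times> nat \<Rightarrow> nat \<Rightarrow> nat" where
  "hash n s = (\<lambda>(\<theta>, \<phi>) j. ((\<theta> * j + \<phi>) mod hash_prime n) mod num_groups n s)"

datatype message =
    Real_Msg (real_of_msg: real)
  | Seed_Msg (seed_of_msg: "nat \<times> nat")
  | Bits_Msg (bits_of_msg: "nat \<Rightarrow> bool")

definition low_degree :: "nat \<Rightarrow> (nat \<Rightarrow> bool) \<Rightarrow> nat" where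
  "low_degree i a = card {j. 1 \<le> j \<and> j < i \<and> a j}"

definition degree_query :: "real \<Rightarrow> nat \<Rightarrow> message query" where
  "degree_query \<epsilon>0 i a = embed_measure (laplace_mech (1 / \<epsilon>0) (real (low_degree i a))) Real_Msg"

text \<open>The space of this measure contains the admissible seeds only; in particular \<open>\<theta> \<noteq> 0\<close>.\<close>

definition seed_dist :: "nat \<Rightarrow> message measure" where
  "seed_dist n =
     embed_measure (uniform_count_measure ({1..hash_prime n - 1} \<times> {0..hash_prime n - 1})) Seed_Msg"

definition rand_resp :: "real \<Rightarrow> bool \<Rightarrow> bool pmf" where
  "rand_resp \<epsilon> b =
     map_pmf (\<lambda>keep. if keep then b else \<not> b) (bernoulli_pmf (exp \<epsilon> / (1 + exp \<epsilon>)))"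

text \<open>\<open>Inl j\<close> stands for user \<open>j\<close>, and the elements \<open>Inr r\<close> are the dummies.\<close>

definition padded_group :: "nat \<Rightarrow> nat \<Rightarrow> nat \<times> nat \<Rightarrow> nat \<Rightarrow> (nat + nat) set" where
  "padded_group n s sd t =
     (let S = {j \<in> {1..n}. hash n s sd j = t} in Inl ` S \<union> Inr ` {..<s - card S})"

definition group_bit :: "nat \<Rightarrow> (nat \<Rightarrow> bool) \<Rightarrow> nat + nat \<Rightarrow> bool" where
  "group_bit i a c = (case c of Inl j \<Rightarrow> j \<le> i \<and> a j | Inr _ \<Rightarrow> False)"

text \<open>The whole vector of bits, one for each group, is the answer to a single query.\<close>

definition group_rr_query :: "nat \<Rightarrow> nat \<Rightarrow> real \<Rightarrow> nat \<times> nat \<Rightarrow> nat \<Rightarrow> message query" where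
  "group_rr_query n s \<epsilon>1 sd i a =
     embed_measure
       (measure_pmf
         (Pi_pmf {..<num_groups n s} False
           (\<lambda>t. pmf_of_set (padded_group n s sd t) \<bind>
                (\<lambda>c. rand_resp (rr_budget s \<epsilon>1) (group_bit i a c)))))
       Bits_Msg"

text \<open>
  In the following, \<open>d\<close>, \<open>sd\<close> and \<open>b\<close> are the published noisy degrees, seeds and bit vectors, all
  indexed by users.
\<close>

definition rr_omega :: "nat \<Rightarrow> nat \<Rightarrow> real \<Rightarrow> real" where
  "rr_omega n s \<epsilon>1 =
     (let m = real (num_groups n s); e = exp (rr_budget s \<epsilon>1)
      in (e + 1) / (e - 1) * ((m * real s - 1) / (m - 1)))"

definition rr_sigma :: "nat \<Rightarrow> nat \<Rightarrow> real \<Rightarrow> (nat \<Rightarrow> real) \<Rightarrow> nat \<Rightarrow> real" where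
  "rr_sigma n s \<epsilon>1 d k =
     (let m = real (num_groups n s); e = exp (rr_budget s \<epsilon>1)
      in (real s - 1) / (m * real s - real s) * d k
         + 1 / (e - 1) * ((m * real s - 1) / (m - 1)))"

definition edge_estimate ::
    "nat \<Rightarrow> nat \<Rightarrow> real \<Rightarrow> (nat \<Rightarrow> real) \<Rightarrow> (nat \<Rightarrow> nat \<times> nat) \<Rightarrow> (nat \<Rightarrow> nat \<Rightarrow> bool)
      \<Rightarrow> nat \<Rightarrow> nat \<Rightarrow> real" where
  "edge_estimate n s \<epsilon>1 d sd b k j =
     rr_omega n s \<epsilon>1 * of_bool (b k (hash n s (sd k) j)) - rr_sigma n s \<epsilon>1 d k"

definition triangle_count ::
    "nat \<Rightarrow> nat \<Rightarrow> real \<Rightarrow> (nat \<Rightarrow> real) \<Rightarrow> (nat \<Rightarrow> nat \<times> nat) \<Rightarrow> (nat \<Rightarrow> nat \<Rightarrow> bool)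
      \<Rightarrow> nat \<Rightarrow> (nat \<Rightarrow> bool) \<Rightarrow> real" where
  "triangle_count n s \<epsilon>1 d sd b i a =
     (\<Sum>(j, k) \<in> {(j, k). 1 \<le> j \<and> j < k \<and> k < i \<and> a j \<and> a k}. edge_estimate n s \<epsilon>1 d sd b k j)"

definition counting_query ::
    "counting_mech \<Rightarrow> nat \<Rightarrow> nat \<Rightarrow> real \<Rightarrow> real \<Rightarrow> (nat \<Rightarrow> real) \<Rightarrow> (nat \<Rightarrow> nat \<times> nat)
      \<Rightarrow> (nat \<Rightarrow> nat \<Rightarrow> bool) \<Rightarrow> nat \<Rightarrow> message query" where
  "counting_query mech n s \<epsilon>1 \<epsilon>2 d sd b i a =
     embed_measure (perturb mech n \<epsilon>2 (triangle_count n s \<epsilon>1 d sd b i) a) Real_Msg"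

definition group_rr ::
    "counting_mech \<Rightarrow> nat \<Rightarrow> nat \<Rightarrow> real \<Rightarrow> real \<Rightarrow> real \<Rightarrow> (message, real) protocol" where
  "group_rr mech n s \<epsilon>0 \<epsilon>1 \<epsilon>2 =
     (let users = [1..<Suc n] in
      ask_each users (degree_query \<epsilon>0) (\<lambda>ds.
      server_each users (\<lambda>_. seed_dist n) (\<lambda>seeds.
      ask_each users (\<lambda>i. group_rr_query n s \<epsilon>1 (seed_of_msg (seeds i)) i) (\<lambda>bits.
      ask_each users
        (counting_query mech n s \<epsilon>1 \<epsilon>2
           (real_of_msg \<circ> ds) (seed_of_msg \<circ> seeds) (bits_of_msg \<circ> bits))
        (\<lambda>counts. Output (\<Sum>i=1..n. real_of_msg (counts i)))))))"

end

theory Submission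
  imports Defs
begin

text \<open>
  Every user answers three queries, so it suffices that they have budgets \<open>\<epsilon>0\<close>, \<open>\<epsilon>1\<close> and \<open>\<epsilon>2\<close>.
  Two lists at distance \<open>1\<close> differ in one entry.  This changes the degree by at most \<open>1\<close>, and it
  affects a single group in the group randomized response, where the factor \<open>s\<close> in
  \<open>exp \<epsilon>' = 1 + s (exp \<epsilon>1 - 1)\<close> compensates for the subsampling.  For the smooth
  sensitivity mechanism, let \<open>\<beta> = \<epsilon>2 / 6\<close>: moving the centre of the density
  \<open>1 / (1 + z ^ 4)\<close> by \<open>\<beta>\<close> costs a factor \<open>exp (3 \<beta>)\<close>, and so does rescaling by a factor
  between \<open>exp (- \<beta>)\<close> and \<open>exp \<beta>\<close>.
\<close>

section \<open>Neighbouring adjacency lists\<close>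

lemma finite_adj_lists: "finite (adj_lists n)"
  unfolding adj_lists_def by (intro finite_PiE) auto

lemma adj_lists_flip: "a \<in> adj_lists n \<Longrightarrow> j \<in> {1..n} \<Longrightarrow> a(j := b) \<in> adj_lists n"
  unfolding adj_lists_def by (auto simp: PiE_def extensional_def)

lemma l1_dist_self: "l1_dist n a a = 0"
  by (simp add: l1_dist_def)

lemma l1_dist_commute: "l1_dist n a a' = l1_dist n a' a"
  by (simp add: l1_dist_def abs_minus_commute)

lemma l1_dist_triangle: "l1_dist n a c \<le> l1_dist n a b + l1_dist n b c"
  unfolding l1_dist_def sum.distrib[symmetric] by (intro sum_mono) auto

lemma l1_dist_flip:
  assumes "j \<in> {1..n}"
  shows "l1_dist n a (a(j := \<not> a j)) = 1"
proof -
  have "l1_dist n a (a(j := \<not> a j)) = (\<Sum>k=1..n. if k = j then 1 else 0)"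
    unfolding l1_dist_def by (intro sum.cong) auto
  then show ?thesis using assms by simp
qed

text \<open>Outside \<open>{1..n}\<close> two adjacency lists agree by extensionality, and two
  distinct positions of disagreement inside it would already contribute 2 to the distance.\<close>

lemma l1_dist_le_1_cases:
  assumes "a \<in> adj_lists n" "a' \<in> adj_lists n" "l1_dist n a a' \<le> 1"
  obtains "a' = a" | j where "j \<in> {1..n}" "a' = a(j := \<not> a j)"
proof (cases "a' = a")
  case True
  then show ?thesis by (rule that(1))
next
  case False
  then obtain j where j: "a' j \<noteq> a j" by auto
  have ext: "a' k = a k" if "k \<notin> {1..n}" for k
    using assms(1,2) that by (auto simp: adj_lists_def PiE_def extensional_def)
  have "a' k = a k" if "k \<noteq> j" for k
  proof (rule ccontr)
    assume k: "a' k \<noteq> a k"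
    have "(2::int) = (\<Sum>i\<in>{j, k}. \<bar>of_bool (a i) - of_bool (a' i)\<bar>)"
      using j k that by auto
    also have "\<dots> \<le> l1_dist n a a'"
      unfolding l1_dist_def using j k ext by (intro sum_mono2) auto
    finally show False using assms(3) by simp
  qed
  then have "a' = a(j := \<not> a j)" using j by (auto simp: fun_eq_iff)
  then show ?thesis using j ext that(2) by blast
qed

text \<open>The common route to all privacy bounds: only one flipped entry has to be analysed. The
  ratio is stated with \<open>emeasure\<close> because densities and pmfs are compared through
  nonnegative integrals. Since \<open>a\<close> ranges over all lists, both orders of a pair are
  covered; equal lists are covered by \<open>\<epsilon> \<ge> 0\<close>.\<close>

lemma edge_ldp_query_flipI:
  assumes "\<epsilon> \<ge> 0"
    and "\<And>a. a \<in> adj_lists n \<Longrightarrow> prob_space (R a)"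
    and "\<And>a. a \<in> adj_lists n \<Longrightarrow> sets (R a) = sets M"
    and ratio: "\<And>a j S. a \<in> adj_lists n \<Longrightarrow> j \<in> {1..n} \<Longrightarrow> S \<in> sets M \<Longrightarrow>
           emeasure (R a) S \<le> ennreal (exp \<epsilon>) * emeasure (R (a(j := \<not> a j))) S"
  shows "edge_ldp_query n \<epsilon> R"
proof -
  have "measure (R a) S \<le> exp \<epsilon> * measure (R a') S"
    if a: "a \<in> adj_lists n" "a' \<in> adj_lists n" "l1_dist n a a' \<le> 1" and S: "S \<in> sets (R a)"
    for a a' S
    using a
  proof (cases rule: l1_dist_le_1_cases)
    case 1
    have "1 * measure (R a) S \<le> exp \<epsilon> * measure (R a) S"
      using \<open>\<epsilon> \<ge> 0\<close> by (intro mult_right_mono) auto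
    then show ?thesis using 1 by simp
  next
    case (2 j)
    interpret A: prob_space "R a" using assms(2) a by blast
    interpret A': prob_space "R a'" using assms(2) a by blast
    have "emeasure (R a) S \<le> ennreal (exp \<epsilon>) * emeasure (R a') S"
      using ratio[of a j S] 2 a S assms(3) by auto
    then show ?thesis
      by (simp add: A.emeasure_eq_measure A'.emeasure_eq_measure flip: ennreal_mult)
  qed
  then show ?thesis using assms(2,3) unfolding edge_ldp_query_def by auto
qed

text \<open>Answers are published as tagged messages. Under an injective tag the events of the
  embedded measure are exactly the images of the original events, with the same
  probabilities.\<close>

lemma edge_ldp_query_embed:
  assumes f: "inj f" and R: "edge_ldp_query n \<epsilon> R"
  shows "edge_ldp_query n \<epsilon> (\<lambda>a. embed_measure (R a) f)"
proof -
  have prob: "prob_space (R a)" if "a \<in> adj_lists n" for a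
    using R that unfolding edge_ldp_query_def by blast
  have sets: "sets (R a) = sets (R a')" if "a \<in> adj_lists n" "a' \<in> adj_lists n" for a a'
    using R that unfolding edge_ldp_query_def by blast
  have ratio: "measure (R a) S \<le> exp \<epsilon> * measure (R a') S"
    if "a \<in> adj_lists n" "a' \<in> adj_lists n" "l1_dist n a a' \<le> 1" "S \<in> sets (R a)" for a a' S
    using R that unfolding edge_ldp_query_def by blast
  have emb: "emeasure (embed_measure M f) (f ` A) = emeasure M A" if "A \<in> sets M" for M A
    by (rule emeasure_embed_measure_image[OF f that])
  have meas: "measure (embed_measure M f) (f ` A) = measure M A" if "A \<in> sets M" for M A
    by (simp only: measure_def emb[OF that])
  show ?thesis
    unfolding edge_ldp_query_def
  proof (intro conjI ballI impI)
    fix a assume "a \<in> adj_lists n"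
    then show "prob_space (embed_measure (R a) f)"
      by (intro prob_spaceI)
        (simp only: space_embed_measure emb[OF sets.top] prob_space.emeasure_space_1[OF prob])
  next
    fix a a' assume "a \<in> adj_lists n" "a' \<in> adj_lists n"
    then show "sets (embed_measure (R a) f) = sets (embed_measure (R a') f)"
      using sets[of a a'] by (simp only: sets_embed_measure[OF f])
  next
    fix a a' S
    assume a: "a \<in> adj_lists n" "a' \<in> adj_lists n" "l1_dist n a a' \<le> 1"
      and "S \<in> sets (embed_measure (R a) f)"
    then obtain A where A: "S = f ` A" "A \<in> sets (R a)"
      by (auto simp only: sets_embed_measure[OF f])
    then have "A \<in> sets (R a')" using sets[OF a(1,2)] by simp
    then show "measure (embed_measure (R a) f) S \<le> exp \<epsilon> * measure (embed_measure (R a') f) S"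
      using A ratio[OF a A(2)] by (simp only: meas)
  qed
qed


section \<open>Additive noise\<close>

text \<open>The substitution \<open>y = \<mu> + \<sigma> * z\<close> produces a factor
  \<open>\<sigma>\<close>, which cancels the division by \<open>\<sigma>\<close> in the transformed
  density.\<close>

lemma emeasure_affine_density:
  fixes h :: "real \<Rightarrow> real"
  assumes [measurable]: "h \<in> borel_measurable borel" "S \<in> sets borel" and "\<sigma> > 0"
  shows "emeasure (distr (density lborel (\<lambda>z. ennreal (h z))) borel (\<lambda>z. \<mu> + \<sigma> * z)) S =
    (\<integral>\<^sup>+y. ennreal (h ((y - \<mu>) / \<sigma>) / \<sigma>) * indicator S y \<partial>lborel)"
proof -
  have "(\<integral>\<^sup>+y. ennreal (h ((y - \<mu>) / \<sigma>) / \<sigma>) * indicator S y \<partial>lborel) =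
      ennreal \<sigma> * (\<integral>\<^sup>+z. ennreal (h z / \<sigma>) * indicator S (\<mu> + \<sigma> * z) \<partial>lborel)"
    using \<open>\<sigma> > 0\<close> by (subst nn_integral_real_affine[where c = \<sigma> and t = \<mu>]) auto
  also have "\<dots> = (\<integral>\<^sup>+z. ennreal \<sigma> * (ennreal (h z / \<sigma>) * indicator S (\<mu> + \<sigma> * z)) \<partial>lborel)"
    by (rule nn_integral_cmult[symmetric]) measurable
  also have "\<dots> = (\<integral>\<^sup>+z. ennreal (h z) * indicator S (\<mu> + \<sigma> * z) \<partial>lborel)"
    using \<open>\<sigma> > 0\<close> by (simp add: mult.assoc[symmetric] ennreal_mult'[symmetric])
  also have "\<dots> = (\<integral>\<^sup>+z. ennreal (h z) * indicator ((\<lambda>z. \<mu> + \<sigma> * z) -` S) z \<partial>lborel)"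
    by (simp add: indicator_def)
  also have "\<dots> = emeasure (distr (density lborel (\<lambda>z. ennreal (h z))) borel (\<lambda>z. \<mu> + \<sigma> * z)) S"
    using measurable_sets_borel[of "\<lambda>z. \<mu> + \<sigma> * z" borel S]
    by (subst emeasure_distr) (auto simp: emeasure_density)
  finally show ?thesis by simp
qed

text \<open>This reduces the privacy of both kinds of noise to a pointwise inequality between
  densities, which is then integrated over the event.\<close>

lemma emeasure_affine_density_le:
  fixes h :: "real \<Rightarrow> real"
  assumes "h \<in> borel_measurable borel" "S \<in> sets borel" and "\<sigma> > 0" "\<sigma>' > 0" "C \<ge> 0"
    and le: "\<And>y. h ((y - \<mu>) / \<sigma>) / \<sigma> \<le> C * (h ((y - \<mu>') / \<sigma>') / \<sigma>')"
  shows "emeasure (distr (density lborel (\<lambda>z. ennreal (h z))) borel (\<lambda>z. \<mu> + \<sigma> * z)) S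
    \<le> ennreal C * emeasure (distr (density lborel (\<lambda>z. ennreal (h z))) borel (\<lambda>z. \<mu>' + \<sigma>' * z)) S"
proof -
  note [measurable] = assms(1,2)
  have "(\<integral>\<^sup>+y. ennreal (h ((y - \<mu>) / \<sigma>) / \<sigma>) * indicator S y \<partial>lborel)
      \<le> (\<integral>\<^sup>+y. ennreal C * (ennreal (h ((y - \<mu>') / \<sigma>') / \<sigma>') * indicator S y) \<partial>lborel)"
    using le \<open>C \<ge> 0\<close>
    by (intro nn_integral_mono)
      (auto simp: indicator_def ennreal_mult'[symmetric] intro!: ennreal_leI)
  also have "\<dots> = ennreal C * (\<integral>\<^sup>+y. ennreal (h ((y - \<mu>') / \<sigma>') / \<sigma>') * indicator S y \<partial>lborel)"
    by (rule nn_integral_cmult) measurable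
  finally show ?thesis
    using assms by (simp add: emeasure_affine_density)
qed

section \<open>Laplace noise\<close>

lemma prob_space_laplace:
  assumes "b \<ge> 0"
  shows "prob_space (laplace b)"
proof (cases "b = 0")
  case True
  then show ?thesis by (simp add: laplace_def prob_space_return)
next
  case False
  with assms have b: "b > 0" by simp
  \<comment> \<open>The Laplace density is the average of the exponential density of rate
    \<open>1 / b\<close> and its mirror image, each of total mass 1.\<close>
  define g where "g = exponential_density (1 / b)"
  have [measurable]: "g \<in> borel_measurable borel" unfolding g_def by measurable
  have g0: "g z \<ge> 0" for z
    unfolding g_def using b by (intro exponential_density_nonneg) auto
  have "prob_space (density lborel g)"
    unfolding g_def using b by (intro prob_space_exponential_density) auto
  then have g1: "(\<integral>\<^sup>+z. ennreal (g z) \<partial>lborel) = 1"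
    by (auto dest!: prob_space.emeasure_space_1 simp: emeasure_density)
  have g2: "(\<integral>\<^sup>+z. ennreal (g (- z)) \<partial>lborel) = 1"
    using nn_integral_real_affine[of "\<lambda>z. ennreal (g z)" "- 1" 0] g1 by simp
  have "emeasure (laplace b) UNIV = (\<integral>\<^sup>+z. ennreal (exp (- \<bar>z\<bar> / b) / (2 * b)) \<partial>lborel)"
    using b by (simp add: laplace_def emeasure_density)
  also have "\<dots> = (\<integral>\<^sup>+z. ennreal (1/2) * (ennreal (g z) + ennreal (g (- z))) \<partial>lborel)"
  proof (intro nn_integral_cong_AE)
    \<comment> \<open>At \<open>z = 0\<close> both halves are nonzero and their average is twice the
      Laplace density, so equality is claimed only off this null set.\<close>
    show "AE z in lborel. ennreal (exp (- \<bar>z\<bar> / b) / (2 * b)) =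
        ennreal (1/2) * (ennreal (g z) + ennreal (g (- z)))"
      using AE_lborel_singleton[of "0::real"]
    proof eventually_elim
      case (elim z)
      then have "exp (- \<bar>z\<bar> / b) / (2 * b) = 1/2 * (g z + g (- z))"
        by (simp add: g_def exponential_density_def)
      then show ?case
        using g0[of z] g0[of "- z"] by (simp only: ennreal_plus[symmetric] ennreal_mult'[symmetric])
    qed
  qed
  also have "\<dots> = ennreal (1/2) * (\<integral>\<^sup>+z. (ennreal (g z) + ennreal (g (- z))) \<partial>lborel)"
    by (rule nn_integral_cmult) measurable
  also have "(\<integral>\<^sup>+z. (ennreal (g z) + ennreal (g (- z))) \<partial>lborel) = 1 + 1"
    by (subst nn_integral_add) (simp_all add: g1 g2)
  also have "ennreal (1/2) * (1 + 1) = 1"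
    by (simp only: ennreal_1[symmetric] ennreal_plus[symmetric] ennreal_mult'[symmetric]
        zero_le_one zero_le_divide_1_iff zero_le_numeral) simp
  finally show ?thesis
    using b by (intro prob_spaceI) (simp add: laplace_def)
qed

lemma sets_laplace [measurable_cong]: "sets (laplace b) = sets borel"
  by (simp add: laplace_def)

lemma prob_space_laplace_mech: "b \<ge> 0 \<Longrightarrow> prob_space (laplace_mech b x)"
  unfolding laplace_mech_def by (intro prob_space.prob_space_distr prob_space_laplace) auto

text \<open>The logarithm of the Laplace density is Lipschitz with constant \<open>1 / b\<close>, so
  moving the centre by at most \<open>\<epsilon> * b\<close> costs at most a factor
  \<open>exp \<epsilon>\<close>. For \<open>b = 0\<close> the centres coincide.\<close>

lemma emeasure_laplace_mech_le:
  assumes "b \<ge> 0" "\<epsilon> \<ge> 0" "\<bar>x - x'\<bar> \<le> \<epsilon> * b" and S: "S \<in> sets borel"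
  shows "emeasure (laplace_mech b x) S \<le> ennreal (exp \<epsilon>) * emeasure (laplace_mech b x') S"
proof (cases "b = 0")
  case True
  with assms have "x' = x" by simp
  moreover have "1 * emeasure (laplace_mech b x) S \<le> ennreal (exp \<epsilon>) * emeasure (laplace_mech b x) S"
    using \<open>\<epsilon> \<ge> 0\<close> by (intro mult_right_mono) auto
  ultimately show ?thesis by simp
next
  case False
  with assms have b: "b > 0" by simp
  \<comment> \<open>The divisions by 1 give the inequality the shape of the affine density bound
    with both scales equal to 1.\<close>
  have "exp (- \<bar>(y - x) / 1\<bar> / b) / (2 * b) / 1
      \<le> exp \<epsilon> * (exp (- \<bar>(y - x') / 1\<bar> / b) / (2 * b) / 1)" for y
  proof -
    have "\<bar>y - x'\<bar> \<le> \<bar>y - x\<bar> + \<epsilon> * b" using assms(3) by linarith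
    then have "\<bar>y - x'\<bar> / b \<le> \<bar>y - x\<bar> / b + \<epsilon>" using b by (simp add: field_simps)
    then have "exp (- \<bar>y - x\<bar> / b) \<le> exp (\<epsilon> + - \<bar>y - x'\<bar> / b)" by simp
    also have "\<dots> = exp \<epsilon> * exp (- \<bar>y - x'\<bar> / b)" by (rule exp_add)
    finally show ?thesis using b by (simp add: field_simps)
  qed
  then have "emeasure (distr (density lborel (\<lambda>z. ennreal (exp (- \<bar>z\<bar> / b) / (2 * b)))) borel (\<lambda>z. x + 1 * z)) S
    \<le> ennreal (exp \<epsilon>) * emeasure (distr (density lborel (\<lambda>z. ennreal (exp (- \<bar>z\<bar> / b) / (2 * b)))) borel (\<lambda>z. x' + 1 * z)) S"
    using S by (intro emeasure_affine_density_le) auto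
  then show ?thesis using b by (simp add: laplace_mech_def laplace_def)
qed

section \<open>The density proportional to \<open>1 / (1 + z ^ 4)\<close>\<close>

lemma integrable_poly_tail_4: "integrable lborel (\<lambda>y::real. 1 / (1 + \<bar>y\<bar> ^ 4))"
proof (rule Bochner_Integration.integrable_bound)
  show "integrable lborel (\<lambda>y::real. 2 * inverse (1 + y^2))"
    using integrable_inverse_1_plus_square by (simp add: set_integrable_def)
  have "1 + y\<^sup>2 \<le> 2 * (1 + y ^ 4)" for y :: real
  proof -
    \<comment> \<open>The sum of squares equals
      \<open>2 * (1 + y ^ 4) - (1 + y ^ 2) - 3/4\<close>.\<close>
    have "0 \<le> (y\<^sup>2 - 1/2)\<^sup>2 + (y\<^sup>2)\<^sup>2" by simp
    then show ?thesis by (simp add: power2_eq_square power4_eq_xxxx algebra_simps)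
  qed
  then show "AE y::real in lborel. norm (1 / (1 + \<bar>y\<bar> ^ 4)) \<le> norm (2 * inverse (1 + y^2))"
    by (auto simp: field_simps add_pos_nonneg)
qed measurable

text \<open>A nonnegative integrable function with integral 0 vanishes almost everywhere, whereas
  this one is positive everywhere and the real line is not a null set.\<close>

lemma poly_tail_4_normalization_pos: "(LINT y|lborel. 1 / (1 + \<bar>y\<bar> ^ 4 :: real)) > 0"
proof -
  have "(LINT y|lborel. 1 / (1 + \<bar>y\<bar> ^ 4 :: real)) \<noteq> 0"
  proof
    assume "(LINT y|lborel. 1 / (1 + \<bar>y\<bar> ^ 4 :: real)) = 0"
    then have "AE y::real in lborel. 1 / (1 + \<bar>y\<bar> ^ 4) = 0"
      by (subst (asm) integral_nonneg_eq_0_iff_AE[OF integrable_poly_tail_4]) auto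
    then have "AE y::real in lborel. False"
      by eventually_elim (simp add: add_pos_nonneg add_nonneg_eq_0_iff)
    then show False using AE_iff_measurable[of UNIV "lborel :: real measure" "\<lambda>_. False"] by simp
  qed
  moreover have "(LINT y|lborel. 1 / (1 + \<bar>y\<bar> ^ 4 :: real)) \<ge> 0"
    by (intro integral_nonneg_AE) auto
  ultimately show ?thesis by linarith
qed

lemma prob_space_poly_tail_4: "prob_space (poly_tail 4)"
proof (rule prob_spaceI)
  let ?I = "LINT y|lborel. 1 / (1 + \<bar>y\<bar> ^ 4 :: real)"
  have "emeasure (poly_tail 4) (space (poly_tail 4)) =
      (\<integral>\<^sup>+z. ennreal ((1 / (1 + \<bar>z\<bar> ^ 4)) / ?I) \<partial>lborel)"
    by (simp add: poly_tail_def emeasure_density)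
  also have "\<dots> = ennreal (LINT z|lborel. (1 / (1 + \<bar>z\<bar> ^ 4)) / ?I)"
    using poly_tail_4_normalization_pos integrable_poly_tail_4
    by (intro nn_integral_eq_integral integrable_divide_zero) auto
  also have "(LINT z|lborel. (1 / (1 + \<bar>z\<bar> ^ 4)) / ?I) = ?I / ?I"
    by (rule integral_divide_zero)
  also have "?I / ?I = 1"
    using poly_tail_4_normalization_pos by simp
  finally show "emeasure (poly_tail 4) (space (poly_tail 4)) = 1" by simp
qed

lemma sets_poly_tail [measurable_cong]: "sets (poly_tail \<gamma>) = sets borel"
  by (simp add: poly_tail_def)

text \<open>The logarithmic derivative of \<open>1 + z ^ 4\<close> is at most \<open>3\<close>, since \<open>4 z\<^sup>3 \<le> 3 (1 + z ^ 4)\<close>.\<close>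

lemma one_plus_power4_shift_le:
  fixes z t :: real
  assumes "t \<ge> 0"
  shows "1 + (z + t) ^ 4 \<le> exp (3 * t) * (1 + z ^ 4)"
proof -
  have deriv: "4 * y ^ 3 \<le> 3 * (1 + y ^ 4)" for y :: real
  proof -
    \<comment> \<open>A certificate by squares, chosen so that the quadratic terms cancel on
      expansion.\<close>
    have "0 \<le> 2 * y\<^sup>2 * (y - 1)\<^sup>2 + (y\<^sup>2 - 1)\<^sup>2 + 2" by simp
    also have "\<dots> = 3 * (1 + y ^ 4) - 4 * y ^ 3"
      by (simp add: power2_eq_square power3_eq_cube power4_eq_xxxx algebra_simps)
    finally show ?thesis by simp
  qed
  \<comment> \<open>The factor \<open>exp (- 3 * y)\<close> turns the bound on the logarithmic
    derivative into monotonicity: the derivative of the product has the sign of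
    \<open>4 * y ^ 3 - 3 * (1 + y ^ 4)\<close>.\<close>
  have decr: "(1 + (z + t) ^ 4) * exp (- 3 * (z + t)) \<le> (1 + z ^ 4) * exp (- 3 * z)"
  proof (rule DERIV_nonpos_imp_nonincreasing[where f = "\<lambda>y. (1 + y ^ 4) * exp (- 3 * y)"])
    fix y :: real
    have "((\<lambda>y. (1 + y ^ 4) * exp (- 3 * y)) has_real_derivative
        (4 * y ^ 3 - 3 * (1 + y ^ 4)) * exp (- 3 * y)) (at y)"
      by (auto intro!: derivative_eq_intros simp: algebra_simps)
    moreover have "(4 * y ^ 3 - 3 * (1 + y ^ 4)) * exp (- 3 * y) \<le> 0"
      using deriv[of y] by (intro mult_nonpos_nonneg) auto
    ultimately show "\<exists>d. ((\<lambda>y. (1 + y ^ 4) * exp (- 3 * y)) has_real_derivative d) (at y) \<and> d \<le> 0"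
      by blast
  qed (use assms in auto)
  have "1 + (z + t) ^ 4 = (1 + (z + t) ^ 4) * (exp (- 3 * (z + t)) * exp (3 * (z + t)))"
    by (simp flip: exp_add)
  also have "\<dots> \<le> (1 + z ^ 4) * (exp (- 3 * z) * exp (3 * (z + t)))"
    unfolding mult.assoc[symmetric] by (intro mult_right_mono decr) simp
  also have "exp (- 3 * z) * exp (3 * (z + t)) = exp (3 * t)"
    by (simp add: algebra_simps flip: exp_add)
  finally show ?thesis by (simp only: mult.commute)
qed

text \<open>Absolute values turn a shift in either direction into the increase
  \<open>\<bar>v\<bar> \<le> \<bar>u\<bar> + t\<close> between nonnegative numbers, on which the
  fourth power is monotone.\<close>

lemma poly_tail_4_slide:
  fixes u v t :: real
  assumes "\<bar>u - v\<bar> \<le> t"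
  shows "1 / (1 + \<bar>u\<bar> ^ 4) \<le> exp (3 * t) * (1 / (1 + \<bar>v\<bar> ^ 4))"
proof -
  have "1 + \<bar>v\<bar> ^ 4 \<le> 1 + (\<bar>u\<bar> + t) ^ 4"
    using assms by (intro add_left_mono power_mono) auto
  also have "\<dots> \<le> exp (3 * t) * (1 + \<bar>u\<bar> ^ 4)"
    using assms by (intro one_plus_power4_shift_le) auto
  finally show ?thesis
    by (simp add: field_simps add_pos_nonneg)
qed

text \<open>Written as \<open>\<sigma> ^ 3 / (\<sigma> ^ 4 + y ^ 4)\<close>, the rescaled densities
  can be cross-multiplied and compared term by term. The term with \<open>y ^ 4\<close> needs the
  cube of \<open>\<sigma> \<le> exp \<beta> * \<sigma>'\<close>, whence the factor
  \<open>exp (3 * \<beta>)\<close>; the other term needs the reverse bound on the scales,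
  once.\<close>

lemma poly_tail_4_dilate:
  fixes y \<sigma> \<sigma>' \<beta> :: real
  assumes "\<sigma> > 0" "\<sigma>' > 0" "\<sigma> \<le> exp \<beta> * \<sigma>'" "\<sigma>' \<le> exp \<beta> * \<sigma>" "\<beta> \<ge> 0"
  shows "1 / (1 + \<bar>y / \<sigma>\<bar> ^ 4) / \<sigma> \<le> exp (3 * \<beta>) * (1 / (1 + \<bar>y / \<sigma>'\<bar> ^ 4) / \<sigma>')"
proof -
  have norm: "1 / (1 + \<bar>y / \<tau>\<bar> ^ 4) / \<tau> = \<tau> ^ 3 / (\<tau> ^ 4 + y ^ 4)" if "\<tau> > 0" for \<tau> :: real
  proof -
    have "1 + \<bar>y / \<tau>\<bar> ^ 4 = (\<tau> ^ 4 + y ^ 4) / \<tau> ^ 4"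
      using that by (simp add: power_divide add_divide_distrib)
    moreover have "\<tau> ^ 4 = \<tau> ^ 3 * \<tau>" by (simp add: power3_eq_cube power4_eq_xxxx)
    ultimately show ?thesis using that by simp
  qed
  have e3: "exp (3 * \<beta>) = exp \<beta> ^ 3" by (simp add: exp_of_nat_mult[symmetric])
  have "\<sigma> ^ 3 \<le> (exp \<beta> * \<sigma>') ^ 3"
    using assms by (intro power_mono) auto
  then have "\<sigma> ^ 3 * y ^ 4 \<le> exp (3 * \<beta>) * \<sigma>' ^ 3 * y ^ 4"
    by (intro mult_right_mono) (auto simp: e3 power_mult_distrib)
  moreover have "\<sigma> ^ 3 * \<sigma>' ^ 4 \<le> exp (3 * \<beta>) * \<sigma>' ^ 3 * \<sigma> ^ 4"
  proof -
    have "\<sigma>' \<le> exp (3 * \<beta>) * \<sigma>"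
    proof (rule order_trans[OF assms(4)])
      show "exp \<beta> * \<sigma> \<le> exp (3 * \<beta>) * \<sigma>"
        using assms by (intro mult_right_mono) auto
    qed
    then have "(\<sigma> ^ 3 * \<sigma>' ^ 3) * \<sigma>' \<le> (\<sigma> ^ 3 * \<sigma>' ^ 3) * (exp (3 * \<beta>) * \<sigma>)"
      using assms by (intro mult_left_mono) auto
    then show ?thesis by (simp add: power3_eq_cube power4_eq_xxxx mult_ac)
  qed
  ultimately have "\<sigma> ^ 3 * (\<sigma>' ^ 4 + y ^ 4) \<le> exp (3 * \<beta>) * \<sigma>' ^ 3 * (\<sigma> ^ 4 + y ^ 4)"
    by (simp add: distrib_left)
  moreover have "\<sigma> ^ 4 + y ^ 4 > 0" "\<sigma>' ^ 4 + y ^ 4 > 0"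
    using assms by (auto intro!: add_pos_nonneg)
  ultimately show ?thesis
    unfolding norm[OF assms(1)] norm[OF assms(2)] by (simp add: field_simps)
qed

text \<open>The comparison passes through the density with centre \<open>\<mu>\<close> and scale
  \<open>\<sigma>'\<close>: changing the scale costs \<open>exp (3 * \<beta>)\<close>, and moving
  the centre by at most \<open>\<beta>\<close> in units of \<open>\<sigma>'\<close> costs the same
  again.\<close>

lemma emeasure_poly_tail_4_le:
  fixes \<mu> \<mu>' \<sigma> \<sigma>' \<beta> :: real
  assumes "\<sigma> \<ge> 0" "\<sigma>' \<ge> 0" "\<sigma> \<le> exp \<beta> * \<sigma>'" "\<sigma>' \<le> exp \<beta> * \<sigma>" "\<beta> \<ge> 0"
    and shift: "\<bar>\<mu> - \<mu>'\<bar> \<le> \<beta> * \<sigma>'" and S: "S \<in> sets borel"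
  shows "emeasure (distr (poly_tail 4) borel (\<lambda>z. \<mu> + \<sigma> * z)) S
    \<le> ennreal (exp (6 * \<beta>)) * emeasure (distr (poly_tail 4) borel (\<lambda>z. \<mu>' + \<sigma>' * z)) S"
proof (cases "\<sigma> = 0 \<or> \<sigma>' = 0")
  case True
  \<comment> \<open>Each scale is at most a multiple of the other, so both vanish together, and the
    shift bound then makes the centres equal.\<close>
  with assms have eq: "\<sigma> = 0" "\<sigma>' = 0" by auto
  with shift have "\<mu>' = \<mu>" by simp
  moreover have "1 * emeasure (distr (poly_tail 4) borel (\<lambda>z. \<mu> + \<sigma> * z)) S
      \<le> ennreal (exp (6 * \<beta>)) * emeasure (distr (poly_tail 4) borel (\<lambda>z. \<mu> + \<sigma> * z)) S"
    using \<open>\<beta> \<ge> 0\<close> by (intro mult_right_mono) auto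
  ultimately show ?thesis using eq by simp
next
  case False
  with assms have pos: "\<sigma> > 0" "\<sigma>' > 0" by auto
  let ?I = "LINT y|lborel. 1 / (1 + \<bar>y\<bar> ^ 4 :: real)"
  have "1 / (1 + \<bar>(y - \<mu>) / \<sigma>\<bar> ^ 4) / ?I / \<sigma>
      \<le> exp (6 * \<beta>) * (1 / (1 + \<bar>(y - \<mu>') / \<sigma>'\<bar> ^ 4) / ?I / \<sigma>')" for y
  proof -
    have "\<bar>(y - \<mu>) / \<sigma>' - (y - \<mu>') / \<sigma>'\<bar> = \<bar>\<mu> - \<mu>'\<bar> / \<sigma>'"
      using pos by (simp add: abs_minus_commute flip: diff_divide_distrib)
    also have "\<dots> \<le> \<beta>" using shift pos by (simp add: field_simps)
    finally have "1 / (1 + \<bar>(y - \<mu>) / \<sigma>'\<bar> ^ 4) \<le> exp (3 * \<beta>) * (1 / (1 + \<bar>(y - \<mu>') / \<sigma>'\<bar> ^ 4))"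
      by (rule poly_tail_4_slide)
    then have "exp (3 * \<beta>) * (1 / (1 + \<bar>(y - \<mu>) / \<sigma>'\<bar> ^ 4) / \<sigma>')
        \<le> exp (3 * \<beta>) * (exp (3 * \<beta>) * (1 / (1 + \<bar>(y - \<mu>') / \<sigma>'\<bar> ^ 4)) / \<sigma>')"
      using pos by (intro mult_left_mono divide_right_mono) auto
    also have "\<dots> = exp (6 * \<beta>) * (1 / (1 + \<bar>(y - \<mu>') / \<sigma>'\<bar> ^ 4) / \<sigma>')"
      by (simp add: exp_add[symmetric])
    finally have "1 / (1 + \<bar>(y - \<mu>) / \<sigma>\<bar> ^ 4) / \<sigma>
        \<le> exp (6 * \<beta>) * (1 / (1 + \<bar>(y - \<mu>') / \<sigma>'\<bar> ^ 4) / \<sigma>')"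
      using poly_tail_4_dilate[OF pos assms(3-5), of "y - \<mu>"] by linarith
    then have "1 / (1 + \<bar>(y - \<mu>) / \<sigma>\<bar> ^ 4) / \<sigma> / ?I
        \<le> exp (6 * \<beta>) * (1 / (1 + \<bar>(y - \<mu>') / \<sigma>'\<bar> ^ 4) / \<sigma>') / ?I"
      using poly_tail_4_normalization_pos by (intro divide_right_mono) auto
    then show ?thesis by (simp add: mult_ac)
  qed
  then show ?thesis
    unfolding poly_tail_def using S pos by (intro emeasure_affine_density_le) auto
qed


section \<open>Sensitivity\<close>

context
  fixes n :: nat and f :: "(nat \<Rightarrow> bool) \<Rightarrow> real"
  assumes n: "n \<ge> 1"
begin

lemma global_sens_ge:
  assumes "a \<in> adj_lists n" "a' \<in> adj_lists n" "l1_dist n a a' = 1"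
  shows "\<bar>f a - f a'\<bar> \<le> global_sens n f"
proof -
  have "finite {\<bar>f a - f a'\<bar> | a a'. a \<in> adj_lists n \<and> a' \<in> adj_lists n \<and> l1_dist n a a' = 1}"
    by (rule finite_subset[of _ "(\<lambda>(a, a'). \<bar>f a - f a'\<bar>) ` (adj_lists n \<times> adj_lists n)"])
      (auto simp: finite_adj_lists)
  then show ?thesis
    unfolding global_sens_def using assms by (intro Max_ge) auto
qed

text \<open>The maximum is meaningful only if some pair of neighbours exists;
  \<open>n \<ge> 1\<close> provides one by flipping entry 1.\<close>

lemma global_sens_nonneg: "global_sens n f \<ge> 0"
proof -
  have a: "(\<lambda>i\<in>{1..n}. False) \<in> adj_lists n" by (simp add: adj_lists_def)
  show ?thesis
    using global_sens_ge[OF a adj_lists_flip[OF a] l1_dist_flip, of 1] n by force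
qed

lemma finite_local_sens:
  "finite {\<bar>f a - f a'\<bar> | a'. a' \<in> adj_lists n \<and> l1_dist n a a' = 1}"
  by (rule finite_subset[of _ "(\<lambda>a'. \<bar>f a - f a'\<bar>) ` adj_lists n"]) (auto simp: finite_adj_lists)

lemma local_sens_ge:
  assumes "a' \<in> adj_lists n" "l1_dist n a a' = 1"
  shows "\<bar>f a - f a'\<bar> \<le> local_sens n f a"
  unfolding local_sens_def using assms finite_local_sens by (intro Max_ge) auto

lemma local_sens_nonneg:
  assumes "a \<in> adj_lists n"
  shows "local_sens n f a \<ge> 0"
  using local_sens_ge[OF adj_lists_flip[OF assms] l1_dist_flip, of 1] n by force

lemma local_sens_le_global_sens:
  assumes "a \<in> adj_lists n"
  shows "local_sens n f a \<le> global_sens n f"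
proof -
  have "a(1 := \<not> a 1) \<in> adj_lists n" "l1_dist n a (a(1 := \<not> a 1)) = 1"
    using n assms by (auto intro!: adj_lists_flip l1_dist_flip)
  then have "{\<bar>f a - f a'\<bar> | a'. a' \<in> adj_lists n \<and> l1_dist n a a' = 1} \<noteq> {}" by blast
  then show ?thesis
    unfolding local_sens_def
    by (subst Max_le_iff[OF finite_local_sens]) (auto intro!: global_sens_ge assms)
qed

lemma finite_local_sens_at:
  "finite {local_sens n f a' | a'. a' \<in> adj_lists n \<and> l1_dist n a a' \<le> int k}"
  by (rule finite_subset[of _ "local_sens n f ` adj_lists n"]) (auto simp: finite_adj_lists)

lemma local_sens_le_local_sens_at:
  "a' \<in> adj_lists n \<Longrightarrow> l1_dist n a a' \<le> int k \<Longrightarrow> local_sens n f a' \<le> local_sens_at n f k a"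
  unfolding local_sens_at_def using finite_local_sens_at by (intro Max_ge) auto

lemma local_sens_at_leI:
  assumes "a \<in> adj_lists n"
    and "\<And>a'. a' \<in> adj_lists n \<Longrightarrow> l1_dist n a a' \<le> int k \<Longrightarrow> local_sens n f a' \<le> C"
  shows "local_sens_at n f k a \<le> C"
proof -
  have "{local_sens n f a' | a'. a' \<in> adj_lists n \<and> l1_dist n a a' \<le> int k} \<noteq> {}"
    using assms(1) l1_dist_self[of n a] by (auto intro!: exI[of _ a])
  then show ?thesis
    unfolding local_sens_at_def
    by (subst Max_le_iff[OF finite_local_sens_at]) (auto intro!: assms)
qed

lemma local_sens_at_nonneg: "a \<in> adj_lists n \<Longrightarrow> local_sens_at n f k a \<ge> 0"
  using local_sens_le_local_sens_at[of a a k] local_sens_nonneg[of a] l1_dist_self[of n a] by simp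

text \<open>The ball of radius \<open>k\<close> around \<open>a\<close> lies in the ball of radius
  \<open>k + 1\<close> around its neighbour \<open>a'\<close>.\<close>

lemma local_sens_at_neighbour_le:
  assumes "a \<in> adj_lists n" "l1_dist n a a' \<le> 1"
  shows "local_sens_at n f k a \<le> local_sens_at n f (Suc k) a'"
proof (rule local_sens_at_leI[OF assms(1)])
  fix c assume "c \<in> adj_lists n" "l1_dist n a c \<le> int k"
  then show "local_sens n f c \<le> local_sens_at n f (Suc k) a'"
    using assms(2) l1_dist_triangle[of n a' c a] l1_dist_commute[of n a a']
    by (intro local_sens_le_local_sens_at) auto
qed

section \<open>Smooth sensitivity\<close>

context
  fixes \<beta> :: real
  assumes \<beta>: "\<beta> \<ge> 0"
begin

lemma smooth_sens_ge:
  assumes "a \<in> adj_lists n"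
  shows "exp (- \<beta> * real k) * local_sens_at n f k a \<le> smooth_sens n f \<beta> a"
  unfolding smooth_sens_def
proof (rule cSUP_upper)
  \<comment> \<open>A real supremum dominates its terms only for a bounded family; the global
    sensitivity is a bound uniform in \<open>k\<close>.\<close>
  show "bdd_above (range (\<lambda>k. exp (- \<beta> * real k) * local_sens_at n f k a))"
  proof (rule bdd_aboveI2)
    fix k :: nat
    have "exp (- \<beta> * real k) * local_sens_at n f k a \<le> 1 * global_sens n f"
      using \<beta> assms local_sens_at_nonneg
      by (intro mult_mono local_sens_at_leI) (auto intro: local_sens_le_global_sens)
    then show "exp (- \<beta> * real k) * local_sens_at n f k a \<le> global_sens n f" by simp
  qed
qed simp

text \<open>The term \<open>k = 0\<close> of the supremum suffices, its ball containing
  \<open>a\<close> itself.\<close>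

lemma local_sens_le_smooth_sens:
  "a \<in> adj_lists n \<Longrightarrow> local_sens n f a \<le> smooth_sens n f \<beta> a"
  using smooth_sens_ge[of a 0] local_sens_le_local_sens_at[of a a 0] l1_dist_self[of n a] by simp

lemma smooth_sens_nonneg: "a \<in> adj_lists n \<Longrightarrow> smooth_sens n f \<beta> a \<ge> 0"
  using local_sens_le_smooth_sens[of a] local_sens_nonneg[of a] by simp

text \<open>An index shift: the \<open>k\<close>-th term for \<open>a\<close> is at most
  \<open>exp \<beta>\<close> times the term of index \<open>k + 1\<close> for \<open>a'\<close>, the
  extra radius being paid for by one more discount factor.\<close>

lemma smooth_sens_neighbour_le:
  assumes "a \<in> adj_lists n" "a' \<in> adj_lists n" "l1_dist n a a' \<le> 1"
  shows "smooth_sens n f \<beta> a \<le> exp \<beta> * smooth_sens n f \<beta> a'"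
  unfolding smooth_sens_def[of n f \<beta> a]
proof (rule cSUP_least)
  fix k :: nat
  have "exp (- \<beta> * real k) * local_sens_at n f k a
      \<le> exp (- \<beta> * real k) * local_sens_at n f (Suc k) a'"
    using assms by (intro mult_left_mono local_sens_at_neighbour_le) auto
  also have "\<dots> = exp \<beta> * (exp (- \<beta> * real (Suc k)) * local_sens_at n f (Suc k) a')"
    by (simp add: exp_add[symmetric] mult.assoc[symmetric] algebra_simps)
  also have "\<dots> \<le> exp \<beta> * smooth_sens n f \<beta> a'"
    using assms by (intro mult_left_mono smooth_sens_ge) auto
  finally show "exp (- \<beta> * real k) * local_sens_at n f k a \<le> exp \<beta> * smooth_sens n f \<beta> a'" .
qed simp

end

lemma edge_ldp_query_perturb:
  assumes "\<epsilon> > 0"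
  shows "edge_ldp_query n \<epsilon> (perturb mech n \<epsilon> f)"
proof (cases mech)
  case Local_Laplacian
  show ?thesis
  proof (rule edge_ldp_query_flipI[where M = borel])
    fix a j and S :: "real set"
    assume a: "a \<in> adj_lists n" "j \<in> {1..n}" and S: "S \<in> sets borel"
    have "\<bar>f a - f (a(j := \<not> a j))\<bar> \<le> global_sens n f"
      using a by (intro global_sens_ge adj_lists_flip l1_dist_flip)
    then show "emeasure (perturb mech n \<epsilon> f a) S
        \<le> ennreal (exp \<epsilon>) * emeasure (perturb mech n \<epsilon> f (a(j := \<not> a j))) S"
      using S assms global_sens_nonneg unfolding Local_Laplacian perturb.simps
      by (intro emeasure_laplace_mech_le) auto
  next
    show "prob_space (perturb mech n \<epsilon> f a)" for a
      using assms global_sens_nonneg unfolding Local_Laplacian perturb.simps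
      by (intro prob_space_laplace_mech) auto
  qed (use assms Local_Laplacian in \<open>auto simp: laplace_mech_def\<close>)
next
  case Smooth_Sensitivity
  \<comment> \<open>With \<open>\<gamma> = 4\<close> the constant \<open>2 * (\<gamma> - 1)\<close>
    is 6. Hence the noise scale is the smooth sensitivity divided by \<open>\<beta>\<close>, and the
    total cost \<open>6 * \<beta>\<close> is the budget.\<close>
  define \<beta> where "\<beta> = \<epsilon> / 6"
  have \<beta>: "\<beta> > 0" using assms by (simp add: \<beta>_def)
  have perturb_eq: "perturb mech n \<epsilon> f a =
      distr (poly_tail 4) borel (\<lambda>z. f a + (smooth_sens n f \<beta> a / \<beta>) * z)" for a
    by (simp add: Smooth_Sensitivity \<beta>_def Let_def mult.commute)
  show ?thesis
  proof (rule edge_ldp_query_flipI[where M = borel])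
    fix a j and S :: "real set"
    assume a: "a \<in> adj_lists n" "j \<in> {1..n}" and S: "S \<in> sets borel"
    define a' where "a' = a(j := \<not> a j)"
    have a': "a' \<in> adj_lists n" "l1_dist n a a' = 1"
      using a unfolding a'_def by (auto intro!: adj_lists_flip l1_dist_flip)
    then have "l1_dist n a' a = 1" by (simp add: l1_dist_commute)
    note a' = a' this
    \<comment> \<open>The local sensitivity is taken at \<open>a'\<close>, not at \<open>a\<close>,
      because the shift is measured against the scale belonging to \<open>a'\<close>.\<close>
    have "\<bar>f a - f a'\<bar> \<le> smooth_sens n f \<beta> a'"
      using local_sens_ge[of a a'] local_sens_le_smooth_sens[of \<beta> a'] a a' \<beta> by auto
    moreover have "smooth_sens n f \<beta> a \<ge> 0" "smooth_sens n f \<beta> a' \<ge> 0"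
      using a a' \<beta> by (auto intro!: smooth_sens_nonneg)
    moreover have "smooth_sens n f \<beta> a \<le> exp \<beta> * smooth_sens n f \<beta> a'"
      "smooth_sens n f \<beta> a' \<le> exp \<beta> * smooth_sens n f \<beta> a"
      using a a' \<beta> by (auto intro!: smooth_sens_neighbour_le)
    ultimately have "emeasure (perturb mech n \<epsilon> f a) S
        \<le> ennreal (exp (6 * \<beta>)) * emeasure (perturb mech n \<epsilon> f a') S"
      unfolding perturb_eq using \<beta> S
      by (intro emeasure_poly_tail_4_le) (auto simp: field_simps)
    then show "emeasure (perturb mech n \<epsilon> f a) S
        \<le> ennreal (exp \<epsilon>) * emeasure (perturb mech n \<epsilon> f (a(j := \<not> a j))) S"
      by (simp add: \<beta>_def a'_def)
  next
    show "prob_space (perturb mech n \<epsilon> f a)" for a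
      unfolding perturb_eq by (intro prob_space.prob_space_distr prob_space_poly_tail_4) measurable
  qed (use assms in \<open>auto simp: perturb_eq\<close>)
qed

end


section \<open>The queries of GroupRR\<close>

lemma edge_ldp_query_degree:
  assumes "\<epsilon> > 0"
  shows "edge_ldp_query n \<epsilon> (degree_query \<epsilon> i)"
  unfolding degree_query_def
proof (rule edge_ldp_query_embed[OF _ edge_ldp_query_flipI[where M = borel]])
  fix a j and S :: "real set"
  assume S: "S \<in> sets borel"
  let ?D = "\<lambda>a. {j. 1 \<le> j \<and> j < i \<and> a j}"
  have fin: "finite (?D a)" for a by (rule finite_subset[of _ "{..<i}"]) auto
  \<comment> \<open>The one-sided bound is used in both directions, which gives sensitivity 1 and
    matches the noise scale \<open>1 / \<epsilon>\<close>.\<close>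
  have "card (?D a) \<le> Suc (card (?D a'))" if "\<And>k. k \<noteq> j \<Longrightarrow> a k = a' k" for a a'
  proof -
    have "card (?D a) \<le> card (insert j (?D a'))"
      using that fin by (intro card_mono) auto
    then show ?thesis using card_insert_le_m1 fin[of a'] by (simp add: card_insert_if split: if_splits)
  qed
  from this[of a "a(j := \<not> a j)"] this[of "a(j := \<not> a j)" a]
  have "\<bar>real (low_degree i a) - real (low_degree i (a(j := \<not> a j)))\<bar> \<le> 1"
    unfolding low_degree_def by simp
  then show "emeasure (laplace_mech (1 / \<epsilon>) (real (low_degree i a))) S
      \<le> ennreal (exp \<epsilon>) * emeasure (laplace_mech (1 / \<epsilon>) (real (low_degree i (a(j := \<not> a j))))) S"
    using S assms by (intro emeasure_laplace_mech_le) auto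
next
  show "prob_space (laplace_mech (1 / \<epsilon>) (real (low_degree i a)))" for a
    using assms by (intro prob_space_laplace_mech) simp
  show "inj Real_Msg" by (rule injI) simp
qed (use assms in \<open>simp_all add: laplace_mech_def\<close>)

lemma edge_ldp_query_counting:
  assumes "n \<ge> 1" "\<epsilon>2 > 0"
  shows "edge_ldp_query n \<epsilon>2 (counting_query mech n s \<epsilon>1 \<epsilon>2 d sd b i)"
  unfolding counting_query_def
proof (rule edge_ldp_query_embed[OF _ edge_ldp_query_perturb])
  show "inj Real_Msg" by (rule injI) simp
qed (use assms in simp_all)

lemma emeasure_pmf_le:
  assumes "C \<ge> 0" "\<And>x. pmf p x \<le> C * pmf q x"
  shows "emeasure (measure_pmf p) S \<le> ennreal C * emeasure (measure_pmf q) S"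
proof -
  have "(\<integral>\<^sup>+x. pmf p x \<partial>count_space S) \<le> (\<integral>\<^sup>+x. ennreal C * pmf q x \<partial>count_space S)"
    using assms by (intro nn_integral_mono) (auto simp flip: ennreal_mult' intro!: ennreal_leI)
  also have "\<dots> = ennreal C * (\<integral>\<^sup>+x. pmf q x \<partial>count_space S)"
    by (rule nn_integral_cmult) simp
  finally show ?thesis by (simp only: nn_integral_pmf)
qed

section \<open>Hash groups and their sizes\<close>

lemma hash_prime: "prime (hash_prime n)" "n < hash_prime n"
proof -
  obtain p where "prime p \<and> n < p" using bigger_prime by blast
  then have "prime (hash_prime n) \<and> n < hash_prime n"
    unfolding hash_prime_def by (rule LeastI)
  then show "prime (hash_prime n)" "n < hash_prime n" by auto
qed

text \<open>Within a residue class a number is determined by its quotient by \<open>m\<close>, and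
  \<open>p \<le> m * s\<close> leaves only \<open>s\<close> possible quotients.\<close>

lemma card_residue_class_le:
  fixes p m s t :: nat
  assumes "p \<le> m * s" "m > 0"
  shows "card {x \<in> {..<p}. x mod m = t} \<le> s"
proof -
  have "inj_on (\<lambda>x. x div m) {x \<in> {..<p}. x mod m = t}"
  proof (rule inj_onI)
    fix x y assume "x \<in> {x \<in> {..<p}. x mod m = t}" "y \<in> {x \<in> {..<p}. x mod m = t}"
      "x div m = y div m"
    then show "x = y" using div_mult_mod_eq[of x m] div_mult_mod_eq[of y m] by simp
  qed
  moreover have "(\<lambda>x. x div m) ` {x \<in> {..<p}. x mod m = t} \<subseteq> {..<s}"
    using assms by (auto intro!: less_mult_imp_div_less simp: mult.commute)
  ultimately have "card {x \<in> {..<p}. x mod m = t} \<le> card {..<s}"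
    by (intro card_inj_on_le) auto
  then show ?thesis by simp
qed

text \<open>Before reduction modulo \<open>m\<close> the hash is injective on the users: a collision
  would make the prime \<open>p\<close> divide \<open>\<theta>\<close> or a difference of two users,
  both positive and below \<open>p\<close>. A group thus embeds into one residue class modulo
  \<open>m\<close>.\<close>

lemma card_hash_group_le:
  assumes "s \<ge> 1" and \<theta>: "\<theta> \<in> {1..hash_prime n - 1}"
  shows "card {j \<in> {1..n}. hash n s (\<theta>, \<phi>) j = t} \<le> s"
proof -
  define p where "p = hash_prime n"
  define m where "m = num_groups n s"
  have p: "prime p" "n < p" using hash_prime by (auto simp: p_def)
  have "real p / real s \<le> real m"
    unfolding m_def num_groups_def p_def by linarith
  then have "real p \<le> real m * real s" using assms(1) by (simp add: field_simps)
  then have ms: "p \<le> m * s" by (metis of_nat_le_iff of_nat_mult)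
  have m0: "m > 0" using ms p by (cases m) (auto simp: prime_gt_0_nat)
  let ?g = "\<lambda>j. (\<theta> * j + \<phi>) mod p"
  have "inj_on ?g {1..n}"
  proof (rule linorder_inj_onI)
    fix x y assume xy: "x < y" "x \<in> {1..n}" "y \<in> {1..n}"
    show "?g x \<noteq> ?g y"
    proof
      assume "?g x = ?g y"
      then have "p dvd (\<theta> * y + \<phi>) - (\<theta> * x + \<phi>)"
        using xy by (intro mod_eq_dvd_iff_nat[THEN iffD1]) auto
      then have "p dvd \<theta> * (y - x)" by (simp add: diff_mult_distrib2)
      then have "p dvd \<theta> \<or> p dvd y - x" using p by (simp add: prime_dvd_mult_iff)
      then show False using \<theta> xy p by (auto dest!: dvd_imp_le simp: p_def)
    qed
  qed auto
  then have inj: "inj_on ?g {j \<in> {1..n}. hash n s (\<theta>, \<phi>) j = t}"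
    by (rule inj_on_subset) auto
  have "card {j \<in> {1..n}. hash n s (\<theta>, \<phi>) j = t} \<le> card {x \<in> {..<p}. x mod m = t}"
    using p by (intro card_inj_on_le[OF inj])
      (auto simp: hash_def p_def m_def prime_gt_0_nat)
  also have "\<dots> \<le> s" using ms m0 by (rule card_residue_class_le)
  finally show ?thesis .
qed

lemma finite_padded_group: "finite (padded_group n s sd t)"
  by (simp add: padded_group_def Let_def)

text \<open>The subtraction in the number of dummies is truncated, so padding reaches exactly
  \<open>s\<close> only because no group exceeds \<open>s\<close>.\<close>

lemma card_padded_group:
  assumes "s \<ge> 1" "fst sd \<in> {1..hash_prime n - 1}"
  shows "card (padded_group n s sd t) = s"
proof -
  let ?S = "{j \<in> {1..n}. hash n s sd j = t}"
  have "card ?S \<le> s"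
    using card_hash_group_le[OF assms, of "snd sd"] by simp
  moreover have "card (Inl ` ?S \<union> Inr ` {..<s - card ?S} :: (nat + nat) set) = card ?S + (s - card ?S)"
    by (subst card_Un_disjoint) (auto simp: card_image)
  ultimately show ?thesis by (simp add: padded_group_def Let_def)
qed

section \<open>Randomized response on a sampled element\<close>

lemma pmf_rand_resp:
  "pmf (rand_resp \<epsilon> b) x = (if x = b then exp \<epsilon> else 1) / (1 + exp \<epsilon>)"
proof -
  have "inj (\<lambda>keep. if keep then b else \<not> b)" by (auto intro!: injI split: if_splits)
  then have "pmf (rand_resp \<epsilon> b) (if k then b else \<not> b) =
      pmf (bernoulli_pmf (exp \<epsilon> / (1 + exp \<epsilon>))) k" for k
    unfolding rand_resp_def by (rule pmf_map_inj')
  \<comment> \<open>The answer \<open>x\<close> arises from exactly one coin value, namely whether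
    \<open>x\<close> agrees with \<open>b\<close>.\<close>
  from this[of "x = b"]
  have "pmf (rand_resp \<epsilon> b) x = pmf (bernoulli_pmf (exp \<epsilon> / (1 + exp \<epsilon>))) (x = b)"
    by (cases b; cases x) simp_all
  moreover have "1 + exp \<epsilon> > 0" by (simp add: add_pos_pos)
  then have "exp \<epsilon> / (1 + exp \<epsilon>) \<le> 1" "1 - exp \<epsilon> / (1 + exp \<epsilon>) = 1 / (1 + exp \<epsilon>)"
    by (simp_all add: divide_simps)
  ultimately show ?thesis by (cases "x = b") simp_all
qed

text \<open>
  Subsampling amplifies privacy: changing one element of a group of size \<open>s\<close> changes the sum of
  the \<open>s\<close> response probabilities by at most \<open>(E - 1) / (1 + E)\<close>, where
  \<open>E - 1 = s (exp \<epsilon> - 1)\<close>, while the sum itself is at least \<open>s / (1 + E)\<close>.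
\<close>

lemma pmf_sampled_rand_resp_le:
  fixes G :: "'a set"
  assumes G: "finite G" "card G = s" "s \<ge> 1" and "\<epsilon> > 0"
    and g: "\<And>c. c \<noteq> c0 \<Longrightarrow> g c = g' c"
  shows "pmf (pmf_of_set G \<bind> (\<lambda>c. rand_resp (rr_budget s \<epsilon>) (g c))) x
    \<le> exp \<epsilon> * pmf (pmf_of_set G \<bind> (\<lambda>c. rand_resp (rr_budget s \<epsilon>) (g' c))) x"
proof -
  define E where "E = exp (rr_budget s \<epsilon>)"
  have e1: "exp \<epsilon> > 1" using \<open>\<epsilon> > 0\<close> by simp
  have E: "E = 1 + real s * (exp \<epsilon> - 1)"
    unfolding E_def rr_budget_def using e1 by (simp add: add_pos_nonneg)
  have E1: "E \<ge> 1" using e1 unfolding E by simp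
  have G0: "G \<noteq> {}" using G by auto
  define w where "w b = pmf (rand_resp (rr_budget s \<epsilon>) b) x" for b
  have w: "1 / (1 + E) \<le> w b" "w b \<le> E / (1 + E)" for b
    using E1 by (auto simp: w_def pmf_rand_resp E_def[symmetric] intro!: divide_right_mono)
  have "(\<Sum>c\<in>G. w (g c)) \<le> (\<Sum>c\<in>G. w (g' c)) + (E - 1) / (1 + E)"
  proof (cases "c0 \<in> G")
    case True
    have "(\<Sum>c\<in>G - {c0}. w (g c)) = (\<Sum>c\<in>G - {c0}. w (g' c))"
      by (intro sum.cong) (auto simp: g)
    moreover have "w (g c0) \<le> w (g' c0) + (E - 1) / (1 + E)"
      using w[of "g c0"] w[of "g' c0"] by (simp add: diff_divide_distrib)
    ultimately show ?thesis
      using sum.remove[OF G(1) True, of "\<lambda>c. w (g c)"] sum.remove[OF G(1) True, of "\<lambda>c. w (g' c)"]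
      by simp
  next
    case False
    have "g c = g' c" if "c \<in> G" for c
      using False that by (intro g) auto
    then have "(\<Sum>c\<in>G. w (g c)) = (\<Sum>c\<in>G. w (g' c))"
      by (intro sum.cong) simp_all
    then show ?thesis using E1 by simp
  qed
  \<comment> \<open>The choice of \<open>rr_budget\<close> enters here: the deviation is
    \<open>exp \<epsilon> - 1\<close> times \<open>s\<close> copies of \<open>1 / (1 + E)\<close>,
    the lower bound on every summand.\<close>
  also have "(E - 1) / (1 + E) = (exp \<epsilon> - 1) * (\<Sum>c\<in>G. 1 / (1 + E))"
    using G by (simp add: E)
  also have "\<dots> \<le> (exp \<epsilon> - 1) * (\<Sum>c\<in>G. w (g' c))"
    using e1 w by (intro mult_left_mono sum_mono) auto
  finally have "(\<Sum>c\<in>G. w (g c)) \<le> exp \<epsilon> * (\<Sum>c\<in>G. w (g' c))"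
    by (simp add: algebra_simps)
  then show ?thesis
    using G G0 by (simp add: pmf_bind_pmf_of_set w_def field_simps)
qed

text \<open>The joint probability is a product in which only the factor at \<open>t0\<close> can
  change. If \<open>t0\<close> lies outside \<open>A\<close>, nothing changes and
  \<open>C \<ge> 1\<close> suffices; vectors deviating from the default \<open>d\<close> outside
  \<open>A\<close> have probability 0.\<close>

lemma pmf_Pi_pmf_le:
  assumes "finite A" "C \<ge> 1"
    and eq: "\<And>t. t \<in> A \<Longrightarrow> t \<noteq> t0 \<Longrightarrow> p t = q t"
    and le: "\<And>x. pmf (p t0) x \<le> C * pmf (q t0) x"
  shows "pmf (Pi_pmf A d p) v \<le> C * pmf (Pi_pmf A d q) v"
proof (cases "\<forall>x. x \<notin> A \<longrightarrow> v x = d")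
  case True
  have "(\<Prod>t\<in>A. pmf (p t) (v t)) \<le> C * (\<Prod>t\<in>A. pmf (q t) (v t))"
  proof (cases "t0 \<in> A")
    case t0: True
    have "(\<Prod>t\<in>A. pmf (p t) (v t)) = pmf (p t0) (v t0) * (\<Prod>t\<in>A - {t0}. pmf (p t) (v t))"
      by (rule prod.remove[OF assms(1) t0])
    also have "(\<Prod>t\<in>A - {t0}. pmf (p t) (v t)) = (\<Prod>t\<in>A - {t0}. pmf (q t) (v t))"
      by (intro prod.cong) (auto simp: eq)
    also have "pmf (p t0) (v t0) * \<dots> \<le> C * pmf (q t0) (v t0) * \<dots>"
      by (intro mult_right_mono le prod_nonneg) auto
    also have "\<dots> = C * (\<Prod>t\<in>A. pmf (q t) (v t))"
      by (simp add: prod.remove[OF assms(1) t0])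
    finally show ?thesis .
  next
    case False
    then have "p t = q t" if "t \<in> A" for t
      using that by (intro eq) auto
    then have "(\<Prod>t\<in>A. pmf (p t) (v t)) = 1 * (\<Prod>t\<in>A. pmf (q t) (v t))"
      by (simp cong: prod.cong)
    also have "\<dots> \<le> C * (\<Prod>t\<in>A. pmf (q t) (v t))"
      using assms(2) by (intro mult_right_mono prod_nonneg) auto
    finally show ?thesis .
  qed
  then show ?thesis using True assms(1) by (simp add: pmf_Pi')
next
  case False
  then show ?thesis using assms(1,2) by (simp add: pmf_Pi_outside)
qed

text \<open>User \<open>j\<close> belongs to the single group \<open>hash n s sd j\<close>, so
  flipping entry \<open>j\<close> alters the law of one published bit. Hence the budget is not
  multiplied by the number of groups.\<close>

lemma edge_ldp_query_group_rr:
  assumes "s \<ge> 1" "\<epsilon> > 0" "fst sd \<in> {1..hash_prime n - 1}"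
  shows "edge_ldp_query n \<epsilon> (group_rr_query n s \<epsilon> sd i)"
  unfolding group_rr_query_def
proof (rule edge_ldp_query_embed[OF _ edge_ldp_query_flipI[where M = "count_space UNIV"]])
  fix a :: "nat \<Rightarrow> bool" and j and S :: "(nat \<Rightarrow> bool) set"
  let ?a' = "a(j := \<not> a j)"
  let ?B = "\<lambda>a t. pmf_of_set (padded_group n s sd t) \<bind>
                (\<lambda>c. rand_resp (rr_budget s \<epsilon>) (group_bit i a c))"
  have bit: "group_bit i a c = group_bit i ?a' c" if "c \<noteq> Inl j" for c
    using that by (auto simp: group_bit_def split: sum.split)
  have card: "card (padded_group n s sd t) = s" for t
    using assms by (intro card_padded_group)
  show "emeasure (measure_pmf (Pi_pmf {..<num_groups n s} False (?B a))) S
      \<le> ennreal (exp \<epsilon>) * emeasure (measure_pmf (Pi_pmf {..<num_groups n s} False (?B ?a'))) S"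
  proof (intro emeasure_pmf_le pmf_Pi_pmf_le[where ?t0.0 = "hash n s sd j"])
    fix t assume t: "t \<noteq> hash n s sd j"
    \<comment> \<open>Nonemptiness makes the group the support of its uniform law, so the two laws
      need agree only on elements of the group, none of which is \<open>Inl j\<close>.\<close>
    have "padded_group n s sd t \<noteq> {}" using card[of t] assms(1) by auto
    then show "?B a t = ?B ?a' t"
      using t by (intro bind_pmf_cong refl arg_cong[of _ _ "rand_resp _"] bit)
        (auto simp: finite_padded_group padded_group_def Let_def)
  next
    show "pmf (?B a (hash n s sd j)) x \<le> exp \<epsilon> * pmf (?B ?a' (hash n s sd j)) x" for x
      using assms bit card by (intro pmf_sampled_rand_resp_le[where ?c0.0 = "Inl j"] finite_padded_group)
  qed (use assms in auto)
next
  show "inj Bits_Msg" by (rule injI) simp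
qed (use assms in \<open>simp_all add: measure_pmf.prob_space_axioms\<close>)


section \<open>Queries posed by a protocol\<close>

inductive_cases poses_OutputE: "poses n (Output x) qs"
inductive_cases poses_ServerE: "poses n (Server M K) qs"
inductive_cases poses_AskE: "poses n (Ask u R K) qs"

text \<open>Within a round the queries do not depend on the answers of that round, so its part of
  the query list is fixed and only the continuation sees the messages.\<close>

lemma poses_ask_eachE:
  assumes "poses n (ask_each is R K) qs"
  obtains msgs qs' where "qs = map (\<lambda>i. (i, R i)) is @ qs'" "poses n (K msgs) qs'"
  using assms
proof (induction "is" arbitrary: K qs thesis)
  case Nil
  then show ?case by auto
next
  case (Cons i "is")
  from Cons.prems(2) obtain msg qs1 where
    qs: "qs = (i, R i) # qs1" "poses n (ask_each is R (\<lambda>msgs. K (msgs(i := msg)))) qs1"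
    by (auto elim: poses_AskE)
  from Cons.IH[OF _ qs(2)] obtain msgs qs' where
    "qs1 = map (\<lambda>i. (i, R i)) is @ qs'" "poses n (K (msgs(i := msg))) qs'"
    by blast
  with qs(1) show ?case by (intro Cons.prems(1)) auto
qed

text \<open>Here, unlike for user answers, it is recorded that the messages are possible ones: the
  group sizes rely on \<open>\<theta> \<noteq> 0\<close>.\<close>

lemma poses_server_eachE:
  assumes "poses n (server_each is M K) qs"
  obtains msgs where "\<And>i. i \<in> set is \<Longrightarrow> msgs i \<in> space (M i)" "poses n (K msgs) qs"
  using assms
proof (induction "is" arbitrary: K thesis)
  case Nil
  then show ?case by auto
next
  case (Cons i "is")
  from Cons.prems(2) obtain msg where
    msg: "msg \<in> space (M i)" "poses n (server_each is M (\<lambda>msgs. K (msgs(i := msg)))) qs"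
    by (auto elim: poses_ServerE)
  from Cons.IH[OF _ msg(2)] obtain msgs where
    msgs: "\<And>i. i \<in> set is \<Longrightarrow> msgs i \<in> space (M i)" "poses n (K (msgs(i := msg))) qs"
    by blast
  show ?case
  proof (rule Cons.prems(1)[OF _ msgs(2)])
    show "(msgs(i := msg)) k \<in> space (M k)" if "k \<in> set (i # is)" for k
      using that msg(1) msgs(1) by auto
  qed
qed

lemma queries_to_append: "queries_to u (qs @ qs') = queries_to u qs @ queries_to u qs'"
  by (simp add: queries_to_def)

lemma queries_to_map:
  assumes "distinct is" "u \<in> set is"
  shows "queries_to u (map (\<lambda>i. (i, R i)) is) = [R u]"
proof -
  have "queries_to u (map (\<lambda>i. (i, R i)) is) = map R (filter (\<lambda>i. i = u) is)"
    by (simp add: queries_to_def filter_map comp_def)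
  also have "filter (\<lambda>i. i = u) is = [u]"
    using assms by (induction "is") (auto simp: filter_empty_conv)
  finally show ?thesis by simp
qed

text \<open>Besides the form of the three queries, only the admissibility of the user's own seed is
  kept. The published data in the counting query may be arbitrary, as its budget holds for every
  such choice.\<close>

lemma poses_group_rrE:
  assumes "poses n (group_rr mech n s \<epsilon>0 \<epsilon>1 \<epsilon>2) qs" "u \<in> {1..n}"
  obtains sd d sds b where "fst sd \<in> {1..hash_prime n - 1}"
    "queries_to u qs = [degree_query \<epsilon>0 u, group_rr_query n s \<epsilon>1 sd u,
       counting_query mech n s \<epsilon>1 \<epsilon>2 d sds b u]"
proof -
  let ?users = "[1..<Suc n]"
  have u: "distinct ?users" "u \<in> set ?users" using assms(2) by auto
  obtain ds qs1 where q1: "qs = map (\<lambda>i. (i, degree_query \<epsilon>0 i)) ?users @ qs1" and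
    p1: "poses n (server_each ?users (\<lambda>_. seed_dist n) (\<lambda>seeds.
      ask_each ?users (\<lambda>i. group_rr_query n s \<epsilon>1 (seed_of_msg (seeds i)) i) (\<lambda>bits.
      ask_each ?users
        (counting_query mech n s \<epsilon>1 \<epsilon>2
           (real_of_msg \<circ> ds) (seed_of_msg \<circ> seeds) (bits_of_msg \<circ> bits))
        (\<lambda>counts. Output (\<Sum>i=1..n. real_of_msg (counts i)))))) qs1"
    using assms(1) unfolding group_rr_def Let_def by (rule poses_ask_eachE)
  from p1 obtain seeds where seeds: "\<And>i. i \<in> set ?users \<Longrightarrow> seeds i \<in> space (seed_dist n)" and
    p2: "poses n (ask_each ?users (\<lambda>i. group_rr_query n s \<epsilon>1 (seed_of_msg (seeds i)) i) (\<lambda>bits.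
      ask_each ?users
        (counting_query mech n s \<epsilon>1 \<epsilon>2
           (real_of_msg \<circ> ds) (seed_of_msg \<circ> seeds) (bits_of_msg \<circ> bits))
        (\<lambda>counts. Output (\<Sum>i=1..n. real_of_msg (counts i))))) qs1"
    by (rule poses_server_eachE) (rule that)
  from p2 obtain bits qs2 where
    q2: "qs1 = map (\<lambda>i. (i, group_rr_query n s \<epsilon>1 (seed_of_msg (seeds i)) i)) ?users @ qs2" and
    p3: "poses n (ask_each ?users
        (counting_query mech n s \<epsilon>1 \<epsilon>2
           (real_of_msg \<circ> ds) (seed_of_msg \<circ> seeds) (bits_of_msg \<circ> bits))
        (\<lambda>counts. Output (\<Sum>i=1..n. real_of_msg (counts i)))) qs2"
    by (rule poses_ask_eachE)
  from p3 obtain counts qs3 where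
    q3: "qs2 = map (\<lambda>i. (i, counting_query mech n s \<epsilon>1 \<epsilon>2
           (real_of_msg \<circ> ds) (seed_of_msg \<circ> seeds) (bits_of_msg \<circ> bits) i)) ?users @ qs3" and
    p4: "poses n (Output (\<Sum>i=1..n. real_of_msg (counts i)) :: (message, real) protocol) qs3"
    by (rule poses_ask_eachE)
  have q4: "qs3 = []" using p4 by (rule poses_OutputE)
  have "fst (seed_of_msg (seeds u)) \<in> {1..hash_prime n - 1}"
    using seeds[OF u(2)] by (auto simp: seed_dist_def space_embed_measure space_uniform_count_measure)
  moreover have "queries_to u [] = []" by (simp add: queries_to_def)
  then have "queries_to u qs = [degree_query \<epsilon>0 u, group_rr_query n s \<epsilon>1 (seed_of_msg (seeds u)) u,
      counting_query mech n s \<epsilon>1 \<epsilon>2 (real_of_msg \<circ> ds) (seed_of_msg \<circ> seeds) (bits_of_msg \<circ> bits) u]"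
    unfolding q1 q2 q3 q4 queries_to_append queries_to_map[OF u] by simp
  ultimately show ?thesis by (rule that)
qed

theorem theorem2:
  fixes n s :: nat and \<epsilon>0 \<epsilon>1 \<epsilon>2 :: real and mech :: counting_mech
  assumes "s \<ge> 1" and "num_groups n s \<ge> 2"
    and "\<epsilon>0 > 0" and "\<epsilon>1 > 0" and "\<epsilon>2 > 0"
  shows "edge_ldp n (\<epsilon>0 + \<epsilon>1 + \<epsilon>2) (group_rr mech n s \<epsilon>0 \<epsilon>1 \<epsilon>2)"
  unfolding edge_ldp_def
proof (intro ballI allI impI)
  fix u qs assume u: "u \<in> {1..n}" and "poses n (group_rr mech n s \<epsilon>0 \<epsilon>1 \<epsilon>2) qs"
  then obtain sd d sds b where sd: "fst sd \<in> {1..hash_prime n - 1}" and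
    qs: "queries_to u qs = [degree_query \<epsilon>0 u, group_rr_query n s \<epsilon>1 sd u,
       counting_query mech n s \<epsilon>1 \<epsilon>2 d sds b u]"
    by (elim poses_group_rrE)
  \<comment> \<open>The budgets are listed in the order of the rounds. The condition
    \<open>n \<ge> 1\<close> of the counting query comes from the existence of the user
    \<open>u\<close>.\<close>
  have "list_all2 (edge_ldp_query n) [\<epsilon>0, \<epsilon>1, \<epsilon>2] (queries_to u qs)"
    unfolding qs using assms u sd
    by (auto intro!: edge_ldp_query_degree edge_ldp_query_group_rr edge_ldp_query_counting)
  then show "\<exists>es. list_all2 (edge_ldp_query n) es (queries_to u qs) \<and> sum_list es \<le> \<epsilon>0 + \<epsilon>1 + \<epsilon>2"
    by (intro exI[of _ "[\<epsilon>0, \<epsilon>1, \<epsilon>2]"]) simp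
qed

end
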